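(* Let $(V,\mathcal B,\mu)$ be a $\sigma$-finite standard measure space and let $\rho$ be a symmetric measure on $(V\times V,\mathcal B\times\mathcal B)$ with disintegration $\rho=\int_V\rho_x\,d\mu(x)$, with $0<c(x):=\rho_x(V)<\infty$ for $\mu$-a.e. $x$. Let $d\nu(x)=c(x)\,d\mu(x)$, $P(x,dy)=c(x)^{-1}d\rho_x(y)$, and $(Jf)(x,y)=f(x)$ for functions $f$ on $V$. Then: (1) $J:L^2(\nu)\to L^2(\rho)$ is an isometry; (2) the co-isometry $J^*:L^2(\rho)\to L^2(\nu)$ is given by $(J^*g)(x)=\int_V g(x,y)\,P(x,dy)$ for $g\in L^2(\rho)$; (3) the operator $J:L^2(\mu)\to L^2(\rho)$, with domain $\{f\in L^2(\mu): Jf\in L^2(\rho)\}$, is densely defined in $L^2(\mu)$ and is, in general, unbounded (i.e. there exist a $\sigma$-finite standard measure space $(V,\mathcal B,\mu)$ and a symmetric measure $\rho$ on $(V\times V,\mathcal B\times\mathcal B)$ with disintegration $\rho=\int_V\rho_x\,d\mu(x)$ and $0<\rho_x(V)<\infty$ for $\mu$-a.e. $x$, for which it is unbounded).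
   Context: $(V,\mathcal B)$ is a standard Borel space and $\mu$ a non-atomic $\sigma$-finite positive measure. A symmetric measure is a $\sigma$-finite measure $\rho$ on $(V\times V,\mathcal B\times\mathcal B)$ with $\rho(A\times B)=\rho(B\times A)$ for all $A,B\in\mathcal B$. The disintegration $\rho=\int_V\rho_x\,d\mu(x)$ means that $x\mapsto\rho_x$ is a measurable family of measures on $(V,\mathcal B)$ with $\iint f\,d\rho=\int_V\left(\int_V f(x,y)\,d\rho_x(y)\right)d\mu(x)$. Function identities are understood up to null sets. *)

theory Defs
  imports "HOL-Analysis.Analysis"
begin

section \<open>Measure spaces\<close>

definition standard_borel :: "'a measure \<Rightarrow> bool" where
  "standard_borel M \<longleftrightarrow>
     (\<exists>X. topspace X = space M \<and> completely_metrizable_space X \<and> second_countable X \<and>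
          sets M = sigma_sets (space M) {U. openin X U})"

definition nonatomic :: "'a measure \<Rightarrow> bool" where
  "nonatomic M \<longleftrightarrow>
     (\<forall>A\<in>sets M. 0 < emeasure M A \<longrightarrow>
        (\<exists>B\<in>sets M. B \<subseteq> A \<and> 0 < emeasure M B \<and> emeasure M B < emeasure M A))"

definition standard_measure_space :: "'a measure \<Rightarrow> bool" where
  "standard_measure_space M \<longleftrightarrow> standard_borel M \<and> sigma_finite_measure M \<and> nonatomic M"

text \<open>Of the measure \<^term>\<open>M\<close>, only the underlying measurable space is used here.\<close>

definition symmetric_measure :: "'a measure \<Rightarrow> ('a \<times> 'a) measure \<Rightarrow> bool" where
  "symmetric_measure M \<rho> \<longleftrightarrow>
     sets \<rho> = sets (M \<Otimes>\<^sub>M M) \<and> sigma_finite_measure \<rho> \<and>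
     (\<forall>A\<in>sets M. \<forall>B\<in>sets M. emeasure \<rho> (A \<times> B) = emeasure \<rho> (B \<times> A))"

text \<open>The measures \<^term>\<open>R x\<close> need not be finite, so the Giry monad of subprobability
  measures is not applicable.\<close>

definition measurable_family :: "'a measure \<Rightarrow> ('a \<Rightarrow> 'a measure) \<Rightarrow> bool" where
  "measurable_family M R \<longleftrightarrow>
     (\<forall>x\<in>space M. sets (R x) = sets M) \<and>
     (\<forall>A\<in>sets M. (\<lambda>x. emeasure (R x) A) \<in> borel_measurable M)"

definition disintegration :: "'a measure \<Rightarrow> ('a \<times> 'a) measure \<Rightarrow> ('a \<Rightarrow> 'a measure) \<Rightarrow> bool" where
  "disintegration M \<rho> R \<longleftrightarrow>
     measurable_family M R \<and>
     (\<forall>f :: 'a \<times> 'a \<Rightarrow> ennreal. f \<in> borel_measurable (M \<Otimes>\<^sub>M M) \<longrightarrow>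
        (\<integral>\<^sup>+ z. f z \<partial>\<rho>) = (\<integral>\<^sup>+ x. (\<integral>\<^sup>+ y. f (x, y) \<partial>R x) \<partial>M))"

definition fibre_mass :: "'a measure \<Rightarrow> ('a \<Rightarrow> 'a measure) \<Rightarrow> 'a \<Rightarrow> ennreal" where
  "fibre_mass M R x = emeasure (R x) (space M)"

definition nu_measure :: "'a measure \<Rightarrow> ('a \<Rightarrow> 'a measure) \<Rightarrow> 'a measure" where
  "nu_measure M R = density M (fibre_mass M R)"

definition transition_measure :: "'a measure \<Rightarrow> ('a \<Rightarrow> 'a measure) \<Rightarrow> 'a \<Rightarrow> 'a measure" where
  "transition_measure M R x = scale_measure (inverse (fibre_mass M R x)) (R x)"


section \<open>Scalars\<close>

text \<open>The class covers real and complex Hilbert spaces at once: \<^typ>\<open>real\<close> (with trivial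
  conjugation) and \<^typ>\<open>complex\<close> (with complex conjugation) are, up to isomorphism, its only
  instances.\<close>

class l2_scalar = real_normed_field + banach + second_countable_topology +
  fixes l2_conj :: "'a \<Rightarrow> 'a"
  assumes l2_conj_add: "l2_conj (x + y) = l2_conj x + l2_conj y"
    and l2_conj_mult: "l2_conj (x * y) = l2_conj x * l2_conj y"
    and l2_conj_scaleR: "l2_conj (scaleR r x) = scaleR r (l2_conj x)"
    and l2_conj_conj: "l2_conj (l2_conj x) = x"
    and mult_l2_conj: "x * l2_conj x = scaleR ((norm x)\<^sup>2) 1"

instantiation real :: l2_scalar
begin

definition l2_conj_real :: "real \<Rightarrow> real" where
  "l2_conj_real x = x"

instance
  by standard (simp_all add: l2_conj_real_def power2_eq_square)

end

instantiation complex :: l2_scalar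
begin

definition l2_conj_complex :: "complex \<Rightarrow> complex" where
  "l2_conj_complex z = cnj z"

instance
  by standard (simp_all add: l2_conj_complex_def scaleR_conv_of_real flip: complex_norm_square)

end


section \<open>The spaces \<open>L\<^sup>2\<close> and operators between them\<close>

text \<open>Elements of \<open>L\<^sup>2\<close> are represented by square-integrable functions. Almost everywhere equal
  functions are not identified; instead, all identities are required almost everywhere, and
  operators are required to respect almost everywhere equality.\<close>

definition L2 :: "'a measure \<Rightarrow> ('a \<Rightarrow> 'k::l2_scalar) set" where
  "L2 M = {f \<in> borel_measurable M. integrable M (\<lambda>x. (norm (f x))\<^sup>2)}"

definition l2_inner :: "'a measure \<Rightarrow> ('a \<Rightarrow> 'k::l2_scalar) \<Rightarrow> ('a \<Rightarrow> 'k) \<Rightarrow> 'k" where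
  "l2_inner M f g = (\<integral>x. f x * l2_conj (g x) \<partial>M)"

definition l2_norm :: "'a measure \<Rightarrow> ('a \<Rightarrow> 'k::l2_scalar) \<Rightarrow> real" where
  "l2_norm M f = sqrt (\<integral>x. (norm (f x))\<^sup>2 \<partial>M)"

definition L2_subspace :: "'a measure \<Rightarrow> ('a \<Rightarrow> 'k::l2_scalar) set \<Rightarrow> bool" where
  "L2_subspace M D \<longleftrightarrow>
     D \<subseteq> L2 M \<and> (\<lambda>x. 0) \<in> D \<and>
     (\<forall>f\<in>D. \<forall>g\<in>D. (\<lambda>x. f x + g x) \<in> D) \<and>
     (\<forall>a. \<forall>f\<in>D. (\<lambda>x. a * f x) \<in> D) \<and>
     (\<forall>f\<in>D. \<forall>g\<in>L2 M. (AE x in M. f x = g x) \<longrightarrow> g \<in> D)"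

text \<open>A linear operator with domain \<^term>\<open>D\<close>, not necessarily bounded.\<close>

definition L2_operator ::
  "'a measure \<Rightarrow> 'b measure \<Rightarrow> ('a \<Rightarrow> 'k::l2_scalar) set \<Rightarrow> (('a \<Rightarrow> 'k) \<Rightarrow> ('b \<Rightarrow> 'k)) \<Rightarrow> bool" where
  "L2_operator M N D T \<longleftrightarrow>
     L2_subspace M D \<and>
     (\<forall>f\<in>D. T f \<in> L2 N) \<and>
     (\<forall>f\<in>D. \<forall>g\<in>D. (AE x in M. f x = g x) \<longrightarrow> (AE y in N. T f y = T g y)) \<and>
     (\<forall>f\<in>D. \<forall>g\<in>D. AE y in N. T (\<lambda>x. f x + g x) y = T f y + T g y) \<and>
     (\<forall>a. \<forall>f\<in>D. AE y in N. T (\<lambda>x. a * f x) y = a * T f y)"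

definition L2_densely_defined :: "'a measure \<Rightarrow> ('a \<Rightarrow> 'k::l2_scalar) set \<Rightarrow> bool" where
  "L2_densely_defined M D \<longleftrightarrow>
     (\<forall>f\<in>L2 M. \<forall>e>0. \<exists>g\<in>D. l2_norm M (\<lambda>x. f x - g x) < e)"

definition L2_bounded ::
  "'a measure \<Rightarrow> 'b measure \<Rightarrow> ('a \<Rightarrow> 'k::l2_scalar) set \<Rightarrow> (('a \<Rightarrow> 'k) \<Rightarrow> ('b \<Rightarrow> 'k)) \<Rightarrow> bool" where
  "L2_bounded M N D T \<longleftrightarrow> (\<exists>C. \<forall>f\<in>D. l2_norm N (T f) \<le> C * l2_norm M f)"

definition L2_isometry ::
  "'a measure \<Rightarrow> 'b measure \<Rightarrow> (('a \<Rightarrow> 'k::l2_scalar) \<Rightarrow> ('b \<Rightarrow> 'k)) \<Rightarrow> bool" where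
  "L2_isometry M N T \<longleftrightarrow>
     L2_operator M N (L2 M) T \<and> (\<forall>f\<in>L2 M. l2_norm N (T f) = l2_norm M f)"

text \<open>\<^term>\<open>S\<close> is the adjoint of the everywhere defined operator \<^term>\<open>T\<close>.\<close>

definition L2_adjoint ::
  "'a measure \<Rightarrow> 'b measure \<Rightarrow> (('a \<Rightarrow> 'k::l2_scalar) \<Rightarrow> ('b \<Rightarrow> 'k)) \<Rightarrow>
    (('b \<Rightarrow> 'k) \<Rightarrow> ('a \<Rightarrow> 'k)) \<Rightarrow> bool" where
  "L2_adjoint M N T S \<longleftrightarrow>
     L2_operator M N (L2 M) T \<and> L2_operator N M (L2 N) S \<and>
     (\<forall>f\<in>L2 M. \<forall>g\<in>L2 N. l2_inner N (T f) g = l2_inner M f (S g))"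

definition L2_coisometry ::
  "'a measure \<Rightarrow> 'b measure \<Rightarrow> (('a \<Rightarrow> 'k::l2_scalar) \<Rightarrow> ('b \<Rightarrow> 'k)) \<Rightarrow> bool" where
  "L2_coisometry M N T \<longleftrightarrow> (\<exists>S. L2_adjoint M N T S \<and> L2_isometry N M S)"


section \<open>The operator \<open>J\<close>\<close>

definition J_op :: "('a \<Rightarrow> 'k) \<Rightarrow> ('a \<times> 'a \<Rightarrow> 'k)" where
  "J_op f = (\<lambda>(x, y). f x)"

definition J_domain :: "'a measure \<Rightarrow> ('a \<times> 'a) measure \<Rightarrow> ('a \<Rightarrow> 'k::l2_scalar) set" where
  "J_domain M \<rho> = {f \<in> L2 M. J_op f \<in> L2 \<rho>}"

end

theory Submission
  imports Defs "HOL-Probability.Giry_Monad"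
begin

text \<open>
  Normalising the fibres gives \<open>\<rho>(dx, dy) = \<nu>(dx) P(x, dy)\<close> with \<open>P\<close> a Markov kernel almost
  everywhere, so \<open>\<nu>\<close> is the first marginal of \<open>\<rho>\<close> and \<open>J\<close>, composition with the first
  projection, is isometric. Fubini's theorem for the kernel \<open>P\<close> identifies the adjoint. Truncating
  \<open>f\<close> to \<open>{x. c x \<le> n}\<close> gives density of the domain in \<open>L\<^sup>2(\<mu>)\<close>, and \<open>J\<close> is unbounded on it as soon
  as \<open>c\<close> is essentially unbounded.
\<close>


section \<open>Square-integrable functions and adjoints\<close>

text \<open>The disintegration formula is given for nonnegative functions only, whereas the adjoint
  identity concerns scalar-valued integrals; a Bochner version is therefore obtained by
  approximation in \<open>L1\<close>. Measurability of fibrewise integrals comes from the space of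
  subprobability measures. The fibres \<open>R x\<close> do not live there, but their normalisations
  do, at every point: where the mass is 0 or \<infinity>, normalising yields the zero measure. This
  is harmless, since it happens on a null set only. Functions stand for their classes, so null sets
  have to be carried between three measures: \<mu> and \<nu> have the same ones because c is
  positive almost everywhere, and those of \<nu> pull back to \<rho>-null sets under the first
  projection. This makes J well defined on classes both over \<nu> and over \<mu>. Uniqueness of
  adjoints then turns the statement that the fibre average is an adjoint into a formula for any
  adjoint.\<close>

lemma norm_l2_conj: "norm (l2_conj x) = norm (x::'k::l2_scalar)"
proof (cases "x = 0")
  case True
  have "l2_conj (0::'k) = 0"
    using l2_conj_add[of 0 "0::'k"] by simp
  with True show ?thesis by simp
next
  case False
  have "norm x * norm (l2_conj x) = norm x * norm x"
    using arg_cong[OF mult_l2_conj, of norm x] by (simp add: norm_mult power2_eq_square)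
  with False show ?thesis by simp
qed

lemma bounded_linear_l2_conj: "bounded_linear (l2_conj :: 'k::l2_scalar \<Rightarrow> 'k)"
  by (rule bounded_linear_intro[where K = 1])
    (simp_all add: l2_conj_add l2_conj_scaleR norm_l2_conj)

lemma borel_measurable_l2_conj [measurable]:
  "(l2_conj :: 'k::l2_scalar \<Rightarrow> 'k) \<in> borel_measurable borel"
  using bounded_linear.continuous_on[OF bounded_linear_l2_conj continuous_on_id]
  by (intro borel_measurable_continuous_onI) simp

lemma L2_borel_measurable: "f \<in> L2 M \<Longrightarrow> f \<in> borel_measurable M"
  by (simp add: L2_def)

lemma L2_integrable: "f \<in> L2 M \<Longrightarrow> integrable M (\<lambda>x. (norm (f x))\<^sup>2)"
  by (simp add: L2_def)

lemma L2_bound: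
  fixes f :: "'a \<Rightarrow> 'k::l2_scalar"
  assumes "f \<in> borel_measurable M" "integrable M h" "\<And>x. (norm (f x))\<^sup>2 \<le> h x"
  shows "f \<in> L2 M"
  using assms unfolding L2_def
  by (auto intro!: Bochner_Integration.integrable_bound[OF assms(2)] AE_I2)
    (metis abs_ge_self order_trans)

lemma L2_add:
  fixes f g :: "'a \<Rightarrow> 'k::l2_scalar"
  assumes "f \<in> L2 M" "g \<in> L2 M"
  shows "(\<lambda>x. f x + g x) \<in> L2 M"
proof (rule L2_bound)
  show "(\<lambda>x. f x + g x) \<in> borel_measurable M"
    using assms by (auto simp: L2_def)
  show "integrable M (\<lambda>x. 2 * (norm (f x))\<^sup>2 + 2 * (norm (g x))\<^sup>2)"
    using assms by (simp add: L2_def)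
  fix x
  have "(norm (f x + g x))\<^sup>2 \<le> (norm (f x) + norm (g x))\<^sup>2"
    by (simp add: power_mono norm_triangle_ineq)
  also have "\<dots> \<le> 2 * (norm (f x))\<^sup>2 + 2 * (norm (g x))\<^sup>2"
    using sum_squares_bound[of "norm (f x)" "norm (g x)"] by (simp add: power2_sum)
  finally show "(norm (f x + g x))\<^sup>2 \<le> 2 * (norm (f x))\<^sup>2 + 2 * (norm (g x))\<^sup>2" .
qed

lemma L2_mult_left: "f \<in> L2 M \<Longrightarrow> (\<lambda>x. a * f x) \<in> L2 M"
  by (auto simp: L2_def norm_mult power_mult_distrib)

lemma L2_diff: "f \<in> L2 M \<Longrightarrow> g \<in> L2 M \<Longrightarrow> (\<lambda>x. f x - g x) \<in> L2 M"
  using L2_add[OF _ L2_mult_left[of g M "-1"], of f] by simp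

lemma L2_subspace_L2: "L2_subspace M (L2 M)"
  unfolding L2_subspace_def by (auto simp: L2_add L2_mult_left) (simp add: L2_def)

lemma integrable_mult_l2_conj:
  fixes f g :: "'a \<Rightarrow> 'k::l2_scalar"
  assumes "f \<in> L2 M" "g \<in> L2 M"
  shows "integrable M (\<lambda>x. f x * l2_conj (g x))"
proof (rule Bochner_Integration.integrable_bound)
  have [measurable]: "f \<in> borel_measurable M" "g \<in> borel_measurable M"
    using assms by (simp_all add: L2_def)
  show "integrable M (\<lambda>x. (norm (f x))\<^sup>2 + (norm (g x))\<^sup>2)"
    using assms by (simp add: L2_def)
  show "(\<lambda>x. f x * l2_conj (g x)) \<in> borel_measurable M"
    by measurable
  show "AE x in M. norm (f x * l2_conj (g x)) \<le> norm ((norm (f x))\<^sup>2 + (norm (g x))\<^sup>2)"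
  proof (rule AE_I2)
    fix x
    show "norm (f x * l2_conj (g x)) \<le> norm ((norm (f x))\<^sup>2 + (norm (g x))\<^sup>2)"
      using sum_squares_bound[of "norm (f x)" "norm (g x)"]
        mult_nonneg_nonneg[of "norm (f x)" "norm (g x)"]
      by (simp add: norm_mult norm_l2_conj del: mult_nonneg_nonneg)
  qed
qed

lemma l2_conj_l2_inner: "l2_conj (l2_inner M f g) = l2_inner M g f"
  if "f \<in> L2 M" "g \<in> L2 M"
  unfolding l2_inner_def
  by (subst integral_bounded_linear[OF bounded_linear_l2_conj, symmetric])
    (simp_all add: integrable_mult_l2_conj that l2_conj_mult l2_conj_conj mult.commute)

lemma l2_inner_diff_right:
  "f \<in> L2 M \<Longrightarrow> g \<in> L2 M \<Longrightarrow> h \<in> L2 M \<Longrightarrow>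
    l2_inner M f (\<lambda>x. g x - h x) = l2_inner M f g - l2_inner M f h"
  unfolding l2_inner_def linear_diff[OF bounded_linear.linear[OF bounded_linear_l2_conj]] right_diff_distrib
  by (intro Bochner_Integration.integral_diff integrable_mult_l2_conj)

lemma l2_inner_self_eq_0D:
  fixes f :: "'a \<Rightarrow> 'k::l2_scalar"
  assumes f: "f \<in> L2 M" and "l2_inner M f f = 0"
  shows "AE x in M. f x = 0"
proof -
  have "l2_inner M f f = (\<integral>x. (norm (f x))\<^sup>2 *\<^sub>R 1 \<partial>M)"
    unfolding l2_inner_def mult_l2_conj ..
  then have "(\<integral>x. (norm (f x))\<^sup>2 \<partial>M) = 0"
    using assms by (simp add: L2_integrable)
  then have "AE x in M. (norm (f x))\<^sup>2 = 0"
    by (subst integral_nonneg_eq_0_iff_AE[symmetric]) (auto simp: L2_integrable f)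
  then show ?thesis by simp
qed

text \<open>Since \<open>2 * t \<le> 1 + t^2\<close>, the norm of f is dominated by
  \<open>1 + (norm f)^2\<close>, where the constant is integrable because the measure is
  finite.\<close>

lemma (in finite_measure) L2_imp_integrable:
  fixes f :: "'a \<Rightarrow> 'k::l2_scalar"
  assumes "f \<in> L2 M"
  shows "integrable M f"
proof (rule Bochner_Integration.integrable_bound)
  show "integrable M (\<lambda>x. 1 + (norm (f x))\<^sup>2)"
    using assms by (simp add: L2_def)
  show "f \<in> borel_measurable M"
    using assms by (simp add: L2_def)
  show "AE x in M. norm (f x) \<le> norm (1 + (norm (f x))\<^sup>2)"
  proof (rule AE_I2)
    fix x
    have "2 * norm (f x) \<le> 1 + (norm (f x))\<^sup>2"
      using sum_squares_bound[of 1 "norm (f x)"] by simp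
    with norm_ge_zero[of "f x"] show "norm (f x) \<le> norm (1 + (norm (f x))\<^sup>2)"
      unfolding real_norm_def by linarith
  qed
qed

text \<open>The variance argument: expand the square of \<open>norm (f x) - m\<close>, whose
  integral is nonnegative. Total mass at most 1 is enough, as it only lowers the term with
  \<open>m^2\<close>. Applied on each fibre, this bounds the fibre average.\<close>

lemma (in subprob_space) norm_integral_power2_le:
  fixes f :: "'a \<Rightarrow> 'k::l2_scalar"
  assumes "f \<in> L2 M"
  shows "(norm (\<integral>x. f x \<partial>M))\<^sup>2 \<le> (\<integral>x. (norm (f x))\<^sup>2 \<partial>M)"
proof -
  define m where "m = (\<integral>x. norm (f x) \<partial>M)"
  have [simp]: "integrable M (\<lambda>x. norm (f x))" "integrable M (\<lambda>x. (norm (f x))\<^sup>2)"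
    using L2_imp_integrable[OF assms] L2_integrable[OF assms] by auto
  have "0 \<le> (\<integral>x. (norm (f x) - m)\<^sup>2 \<partial>M)"
    by simp
  also have "\<dots> = (\<integral>x. (norm (f x))\<^sup>2 + m\<^sup>2 - 2 * norm (f x) * m \<partial>M)"
    by (simp add: power2_diff)
  also have "\<dots> = (\<integral>x. (norm (f x))\<^sup>2 \<partial>M) + m\<^sup>2 * measure M (space M) - 2 * m * m"
    by (simp add: m_def)
  also have "\<dots> \<le> (\<integral>x. (norm (f x))\<^sup>2 \<partial>M) + m\<^sup>2 - 2 * m * m"
    using mult_left_mono[OF subprob_measure_le_1, of "m\<^sup>2" "space M"] by simp
  finally have "m\<^sup>2 \<le> (\<integral>x. (norm (f x))\<^sup>2 \<partial>M)"
    by (simp add: power2_eq_square)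
  moreover have "(norm (\<integral>x. f x \<partial>M))\<^sup>2 \<le> m\<^sup>2"
    unfolding m_def by (intro power_mono integral_norm_bound) simp
  ultimately show ?thesis by simp
qed

section \<open>Uniqueness and symmetry of adjoints\<close>

lemma L2_adjoint_unique:
  fixes T :: "('a \<Rightarrow> 'k::l2_scalar) \<Rightarrow> 'b \<Rightarrow> 'k"
  assumes S: "L2_adjoint M N T S" and S': "L2_adjoint M N T S'" and g: "g \<in> L2 N"
  shows "AE x in M. S g x = S' g x"
proof -
  have Sg: "S g \<in> L2 M" "S' g \<in> L2 M"
    using S S' g by (auto simp: L2_adjoint_def L2_operator_def)
  \<comment> \<open>Testing both adjoint identities against the difference itself gives it inner
    product 0 with itself.\<close>
  let ?d = "\<lambda>x. S g x - S' g x"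
  have d: "?d \<in> L2 M"
    using Sg by (rule L2_diff)
  have "l2_inner M ?d ?d = l2_inner M ?d (S g) - l2_inner M ?d (S' g)"
    by (rule l2_inner_diff_right[OF d Sg])
  also have "\<dots> = l2_inner N (T ?d) g - l2_inner N (T ?d) g"
    using S S' d g by (simp add: L2_adjoint_def)
  finally show ?thesis
    using l2_inner_self_eq_0D[OF d] by simp
qed

text \<open>Conjugating the adjoint identity swaps the two arguments. This allows J to serve as the
  isometric adjoint that witnesses the co-isometry property.\<close>

lemma L2_adjoint_sym:
  fixes T :: "('a \<Rightarrow> 'k::l2_scalar) \<Rightarrow> 'b \<Rightarrow> 'k"
  assumes "L2_adjoint M N T S"
  shows "L2_adjoint N M S T"
  unfolding L2_adjoint_def
proof (intro conjI ballI)
  fix g :: "'b \<Rightarrow> 'k" and f :: "'a \<Rightarrow> 'k" assume g: "g \<in> L2 N" and f: "f \<in> L2 M"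
  have "S g \<in> L2 M" "T f \<in> L2 N"
    using assms f g by (auto simp: L2_adjoint_def L2_operator_def)
  then have "l2_inner M (S g) f = l2_conj (l2_inner M f (S g))"
    "l2_inner N g (T f) = l2_conj (l2_inner N (T f) g)"
    using f g by (simp_all add: l2_conj_l2_inner)
  then show "l2_inner M (S g) f = l2_inner N g (T f)"
    using assms f g by (simp add: L2_adjoint_def)
qed (use assms in \<open>auto simp: L2_adjoint_def\<close>)

section \<open>Disintegrations into probability kernels\<close>

text \<open>The base measure \<open>M\<close> is to be instantiated by \<nu>, not by \<mu>. Mass 1
  is asked for almost everywhere only, because normalising a fibre of mass 0 or \<infinity> gives
  the zero measure.\<close>

locale markov_disintegration =
  fixes M :: "'a measure" and \<rho> :: "('a \<times> 'a) measure" and K :: "'a \<Rightarrow> 'a measure"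
  assumes sets_rho [measurable_cong]: "sets \<rho> = sets (M \<Otimes>\<^sub>M M)"
    and kernel [measurable]: "K \<in> measurable M (subprob_algebra M)"
    and total: "AE x in M. emeasure (K x) (space M) = 1"
    and nn_integral_rho: "\<And>f :: 'a \<times> 'a \<Rightarrow> ennreal. f \<in> borel_measurable (M \<Otimes>\<^sub>M M) \<Longrightarrow>
      (\<integral>\<^sup>+ z. f z \<partial>\<rho>) = (\<integral>\<^sup>+ x. (\<integral>\<^sup>+ y. f (x, y) \<partial>K x) \<partial>M)"
begin

section \<open>The first marginal and the isometry\<close>

lemma distr_fst: "distr \<rho> M fst = M"
proof (rule measure_eqI)
  fix A assume "A \<in> sets (distr \<rho> M fst)"
  then have [measurable]: "A \<in> sets M" by simp
  have "emeasure (distr \<rho> M fst) A = (\<integral>\<^sup>+ z. indicator A z \<partial>distr \<rho> M fst)"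
    by simp
  also have "\<dots> = (\<integral>\<^sup>+ z. indicator A (fst z) \<partial>\<rho>)"
    by (rule nn_integral_distr) measurable
  also have "\<dots> = (\<integral>\<^sup>+ x. (\<integral>\<^sup>+ y. indicator A x \<partial>K x) \<partial>M)"
    by (subst nn_integral_rho) simp_all
  also have "\<dots> = (\<integral>\<^sup>+ x. indicator A x \<partial>M)"
    using total AE_space
  proof (intro nn_integral_cong_AE, eventually_elim)
    fix x assume "emeasure (K x) (space M) = 1" "x \<in> space M"
    then show "(\<integral>\<^sup>+ y. indicator A x \<partial>K x) = indicator A x"
      using sets_eq_imp_space_eq[OF sets_kernel[OF kernel]] by simp
  qed
  finally show "emeasure (distr \<rho> M fst) A = emeasure M A" by simp
qed simp

lemma AE_fst: "AE x in M. P x \<Longrightarrow> AE z in \<rho>. P (fst z)"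
  by (rule AE_distrD[of fst \<rho> M P, unfolded distr_fst]) simp_all

lemma integral_J_op:
  fixes f :: "'a \<Rightarrow> 'k::{banach, second_countable_topology}"
  assumes [measurable]: "f \<in> borel_measurable M"
  shows "(\<integral>z. f (fst z) \<partial>\<rho>) = (\<integral>x. f x \<partial>M)"
    and "integrable \<rho> (\<lambda>z. f (fst z)) \<longleftrightarrow> integrable M f"
  using integral_distr[of fst \<rho> M f] integrable_distr_eq[of fst \<rho> M f]
  by (simp_all add: distr_fst)

lemma J_op_L2: "f \<in> L2 M \<Longrightarrow> J_op f \<in> L2 \<rho>"
  using integral_J_op(2)[of "\<lambda>x. (norm (f x))\<^sup>2"]
  by (auto simp: L2_def J_op_def case_prod_beta)

lemma isometry_J_op: "L2_isometry M \<rho> (J_op :: ('a \<Rightarrow> 'k::l2_scalar) \<Rightarrow> _)"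
  unfolding L2_isometry_def L2_operator_def
proof (intro conjI ballI allI impI)
  fix f g :: "'a \<Rightarrow> 'k" assume "AE x in M. f x = g x"
  from AE_fst[OF this] show "AE z in \<rho>. J_op f z = J_op g z"
    by (simp add: J_op_def case_prod_beta)
next
  fix f :: "'a \<Rightarrow> 'k" assume "f \<in> L2 M"
  then show "l2_norm \<rho> (J_op f) = l2_norm M f"
    using integral_J_op(1)[of "\<lambda>x. (norm (f x))\<^sup>2"]
    by (auto simp: l2_norm_def J_op_def case_prod_beta L2_def)
qed (simp_all add: L2_subspace_L2 J_op_L2, simp_all add: J_op_def case_prod_beta)

section \<open>Fubini's theorem for a kernel, from nonnegative to Banach-valued functions\<close>

lemma measurable_section:
  assumes "F \<in> borel_measurable (M \<Otimes>\<^sub>M M)" "x \<in> space M"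
  shows "(\<lambda>y. F (x, y)) \<in> borel_measurable (K x)"
  using measurable_compose[OF measurable_Pair1'[OF assms(2)] assms(1)]
  by (simp add: measurable_cong_sets[OF sets_kernel[OF kernel assms(2)] refl])

lemma measurable_nn_integral_kernel [measurable]:
  fixes F :: "'a \<times> 'a \<Rightarrow> ennreal"
  assumes "F \<in> borel_measurable (M \<Otimes>\<^sub>M M)"
  shows "(\<lambda>x. \<integral>\<^sup>+y. F (x, y) \<partial>K x) \<in> borel_measurable M"
  by (rule nn_integral_measurable_subprob_algebra2[OF _ kernel]) (simp add: assms)

text \<open>The integrand \<open>F (x, y)\<close> varies with x together with the measure. Pushing
  \<open>K x\<close> forward along \<open>y \<mapsto> (x, y)\<close> moves the whole dependence on x
  into a measure on the product, so that the fixed function \<open>F\<close> is integrated against a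
  measurable family.\<close>

lemma measurable_integral_kernel [measurable]:
  fixes F :: "'a \<times> 'a \<Rightarrow> 'k::{banach, second_countable_topology}"
  assumes [measurable]: "F \<in> borel_measurable (M \<Otimes>\<^sub>M M)"
  shows "(\<lambda>x. \<integral>y. F (x, y) \<partial>K x) \<in> borel_measurable M"
proof -
  note integral_measurable_subprob_algebra [measurable] measurable_distr2 [measurable]
  have "(\<lambda>x. \<integral>z. F z \<partial>distr (K x) (M \<Otimes>\<^sub>M M) (\<lambda>y. (x, y))) \<in> borel_measurable M"
    by measurable
  also have "?this \<longleftrightarrow> ?thesis"
  proof (rule measurable_cong)
    fix x assume "x \<in> space M"
    then show "(\<integral>z. F z \<partial>distr (K x) (M \<Otimes>\<^sub>M M) (\<lambda>y. (x, y))) = (\<integral>y. F (x, y) \<partial>K x)"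
      by (subst integral_distr)
        (simp_all add: measurable_cong_sets[OF sets_kernel[OF kernel] refl])
  qed
  finally show ?thesis .
qed

lemma AE_integrable_kernel:
  fixes F :: "'a \<times> 'a \<Rightarrow> 'k::{banach, second_countable_topology}"
  assumes F: "integrable \<rho> F"
  shows "AE x in M. integrable (K x) (\<lambda>y. F (x, y))"
proof -
  have [measurable]: "F \<in> borel_measurable (M \<Otimes>\<^sub>M M)"
    using borel_measurable_integrable[OF F] by (simp add: measurable_cong_sets[OF sets_rho refl])
  have "(\<integral>\<^sup>+x. (\<integral>\<^sup>+y. ennreal (norm (F (x, y))) \<partial>K x) \<partial>M) \<noteq> \<infinity>"
    using F by (subst nn_integral_rho[symmetric]) (auto simp: integrable_iff_bounded)
  then have "AE x in M. (\<integral>\<^sup>+y. ennreal (norm (F (x, y))) \<partial>K x) \<noteq> \<infinity>"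
    by (rule nn_integral_PInf_AE[rotated]) measurable
  with AE_space show ?thesis
    by eventually_elim (auto simp: integrable_iff_bounded measurable_section less_top)
qed

text \<open>The triangle inequality on each fibre, followed by the disintegration formula for the
  norm. This \<open>L1\<close> contraction yields integrability of the inner integral and, later,
  continuity of the iterated integral.\<close>

lemma nn_integral_norm_integral_le:
  fixes F :: "'a \<times> 'a \<Rightarrow> 'k::{banach, second_countable_topology}"
  assumes F: "integrable \<rho> F"
  shows "(\<integral>\<^sup>+x. ennreal (norm (\<integral>y. F (x, y) \<partial>K x)) \<partial>M) \<le> ennreal (\<integral>z. norm (F z) \<partial>\<rho>)"
proof -
  have [measurable]: "F \<in> borel_measurable (M \<Otimes>\<^sub>M M)"
    using borel_measurable_integrable[OF F] by (simp add: measurable_cong_sets[OF sets_rho refl])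
  have "(\<integral>\<^sup>+x. ennreal (norm (\<integral>y. F (x, y) \<partial>K x)) \<partial>M)
      \<le> (\<integral>\<^sup>+x. (\<integral>\<^sup>+y. ennreal (norm (F (x, y))) \<partial>K x) \<partial>M)"
    using AE_integrable_kernel[OF F]
    by (intro nn_integral_mono_AE, eventually_elim) (rule integral_norm_bound_ennreal)
  also have "\<dots> = (\<integral>\<^sup>+z. ennreal (norm (F z)) \<partial>\<rho>)"
    by (rule nn_integral_rho[symmetric]) measurable
  also have "\<dots> = ennreal (\<integral>z. norm (F z) \<partial>\<rho>)"
    using F by (intro nn_integral_eq_integral) auto
  finally show ?thesis .
qed

lemma integrable_integral_kernel:
  fixes F :: "'a \<times> 'a \<Rightarrow> 'k::{banach, second_countable_topology}"
  assumes F: "integrable \<rho> F"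
  shows "integrable M (\<lambda>x. \<integral>y. F (x, y) \<partial>K x)"
  using borel_measurable_integrable[OF F] nn_integral_norm_integral_le[OF F]
  by (auto simp: integrable_iff_bounded measurable_cong_sets[OF sets_rho refl]
      intro: le_less_trans)

lemma norm_integral_integral_le:
  fixes F :: "'a \<times> 'a \<Rightarrow> 'k::{banach, second_countable_topology}"
  assumes F: "integrable \<rho> F"
  shows "norm (\<integral>x. (\<integral>y. F (x, y) \<partial>K x) \<partial>M) \<le> (\<integral>z. norm (F z) \<partial>\<rho>)"
proof -
  have "ennreal (norm (\<integral>x. (\<integral>y. F (x, y) \<partial>K x) \<partial>M))
      \<le> (\<integral>\<^sup>+x. ennreal (norm (\<integral>y. F (x, y) \<partial>K x)) \<partial>M)"
    by (rule integral_norm_bound_ennreal[OF integrable_integral_kernel[OF F]])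
  also note nn_integral_norm_integral_le[OF F]
  finally show ?thesis by simp
qed

lemma integral_kernel_add:
  fixes F G :: "'a \<times> 'a \<Rightarrow> 'k::{banach, second_countable_topology}"
  assumes "integrable \<rho> F" "integrable \<rho> G"
  shows "(\<integral>x. (\<integral>y. F (x, y) + G (x, y) \<partial>K x) \<partial>M) =
    (\<integral>x. (\<integral>y. F (x, y) \<partial>K x) \<partial>M) + (\<integral>x. (\<integral>y. G (x, y) \<partial>K x) \<partial>M)"
proof -
  have "AE x in M. (\<integral>y. F (x, y) + G (x, y) \<partial>K x) =
      (\<integral>y. F (x, y) \<partial>K x) + (\<integral>y. G (x, y) \<partial>K x)"
    using assms[THEN AE_integrable_kernel] by eventually_elim simp
  then have "(\<integral>x. (\<integral>y. F (x, y) + G (x, y) \<partial>K x) \<partial>M) =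
      (\<integral>x. (\<integral>y. F (x, y) \<partial>K x) + (\<integral>y. G (x, y) \<partial>K x) \<partial>M)"
    using assms integrable_integral_kernel[of "\<lambda>z. F z + G z"]
    by (intro integral_cong_AE borel_measurable_integrable) (auto intro!: integrable_integral_kernel)
  then show ?thesis
    using assms by (simp add: integrable_integral_kernel)
qed

lemma integral_rho:
  fixes F :: "'a \<times> 'a \<Rightarrow> 'k::{banach, second_countable_topology}"
  assumes "integrable \<rho> F"
  shows "(\<integral>z. F z \<partial>\<rho>) = (\<integral>x. (\<integral>y. F (x, y) \<partial>K x) \<partial>M)"
  using assms
proof (induction F)
  case (base A c)
  have [measurable]: "A \<in> sets (M \<Otimes>\<^sub>M M)"
    using base by (simp add: sets_rho)
  let ?g = "\<lambda>x. \<integral>y. indicator A (x, y) \<partial>K x :: real"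
  have int: "integrable \<rho> (indicator A :: _ \<Rightarrow> real)"
    using base by simp
  have "ennreal (\<integral>x. ?g x \<partial>M) = (\<integral>\<^sup>+x. ennreal (?g x) \<partial>M)"
    using integrable_integral_kernel[OF int]
    by (intro nn_integral_eq_integral[symmetric]) auto
  also have "\<dots> = (\<integral>\<^sup>+x. (\<integral>\<^sup>+y. ennreal (indicator A (x, y)) \<partial>K x) \<partial>M)"
    using AE_integrable_kernel[OF int]
    by (intro nn_integral_cong_AE, eventually_elim) (simp add: nn_integral_eq_integral)
  also have "\<dots> = (\<integral>\<^sup>+z. ennreal (indicator A z) \<partial>\<rho>)"
    by (rule nn_integral_rho[symmetric]) measurable
  also have "\<dots> = ennreal (\<integral>z. indicator A z \<partial>\<rho>)"
    using int by (intro nn_integral_eq_integral) auto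
  finally have *: "(\<integral>x. ?g x \<partial>M) = (\<integral>z. indicator A z \<partial>\<rho>)"
    by (subst (asm) ennreal_inj) auto
  have "AE x in M. (\<integral>y. indicator A (x, y) *\<^sub>R c \<partial>K x) = ?g x *\<^sub>R c"
    using AE_integrable_kernel[OF int] by eventually_elim simp
  then have "(\<integral>x. (\<integral>y. indicator A (x, y) *\<^sub>R c \<partial>K x) \<partial>M) = (\<integral>x. ?g x *\<^sub>R c \<partial>M)"
    by (intro integral_cong_AE) measurable
  also have "\<dots> = (\<integral>z. indicator A z *\<^sub>R c \<partial>\<rho>)"
    using integrable_integral_kernel[OF int] int by (simp add: *)
  finally show ?case ..
next
  case (add F G)
  then show ?case by (simp add: integral_kernel_add)
next
  case (lim F S)
  \<comment> \<open>Both sides are continuous in the \<open>L\<^sup>1(\<rho>)\<close>-norm, and \<open>S\<close> converges to \<open>F\<close> in that norm.\<close>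
  let ?I = "\<lambda>F :: 'a \<times> 'a \<Rightarrow> 'k. \<integral>x. (\<integral>y. F (x, y) \<partial>K x) \<partial>M"
  have conv: "(\<lambda>i. \<integral>z. norm (S i z - F z) \<partial>\<rho>) \<longlonglongrightarrow> (\<integral>z. 0 \<partial>\<rho>)"
  \<comment> \<open>The approximations satisfy \<open>norm (S i z) \<le> 2 * norm (F z)\<close>;
    subtracting \<open>F z\<close> adds one more copy of its norm.\<close>
  proof (rule integral_dominated_convergence[where w = "\<lambda>z. 3 * norm (F z)"])
    show "AE z in \<rho>. (\<lambda>i. norm (S i z - F z)) \<longlonglongrightarrow> 0"
    proof (rule AE_I2)
      fix z assume "z \<in> space \<rho>"
      from LIM_zero[OF lim.hyps(2)[OF this]] show "(\<lambda>i. norm (S i z - F z)) \<longlonglongrightarrow> 0"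
        by (rule tendsto_norm_zero)
    qed
    fix i
    show "AE z in \<rho>. norm (norm (S i z - F z)) \<le> 3 * norm (F z)"
    proof (rule AE_I2)
      fix z assume "z \<in> space \<rho>"
      from lim.hyps(3)[OF this, of i] norm_triangle_ineq4[of "S i z" "F z"]
      show "norm (norm (S i z - F z)) \<le> 3 * norm (F z)" by simp
    qed
  qed (use lim.hyps(1,4) in auto)
  \<comment> \<open>Additivity for \<open>S i = (S i - F) + F\<close> identifies the difference of
    iterated integrals with the one of \<open>S i - F\<close>, to which the contraction
    applies.\<close>
  have bound: "norm (?I (S i) - ?I F) \<le> (\<integral>z. norm (S i z - F z) \<partial>\<rho>)" for i
    using integral_kernel_add[of "\<lambda>z. S i z - F z" F] lim.hyps(1,4)
      norm_integral_integral_le[of "\<lambda>z. S i z - F z"] by simp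
  have "(\<lambda>i. ?I (S i) - ?I F) \<longlonglongrightarrow> 0"
    by (rule Lim_null_comparison[OF _ conv[simplified]]) (simp add: bound)
  then have "(\<lambda>i. \<integral>z. S i z \<partial>\<rho>) \<longlonglongrightarrow> ?I F"
    unfolding lim.IH by (rule LIM_zero_cancel)
  moreover have "(\<lambda>i. \<integral>z. S i z \<partial>\<rho>) \<longlonglongrightarrow> (\<integral>z. F z \<partial>\<rho>)"
    using lim.hyps by (intro integral_dominated_convergence[where w = "\<lambda>z. 2 * norm (F z)"]) auto
  ultimately show ?case
    using LIMSEQ_unique by blast
qed

section \<open>Averaging over fibres: conditional expectation given the first coordinate, as the
  adjoint of J\<close>

definition fibre_average :: "('a \<times> 'a \<Rightarrow> 'k::l2_scalar) \<Rightarrow> 'a \<Rightarrow> 'k" where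
  "fibre_average g x = (\<integral>y. g (x, y) \<partial>K x)"

lemma L2_rho_measurable: "g \<in> L2 \<rho> \<Longrightarrow> g \<in> borel_measurable (M \<Otimes>\<^sub>M M)"
  by (simp add: L2_def measurable_cong_sets[OF sets_rho refl])

lemma AE_L2_kernel:
  fixes g :: "'a \<times> 'a \<Rightarrow> 'k::l2_scalar"
  assumes g: "g \<in> L2 \<rho>"
  shows "AE x in M. (\<lambda>y. g (x, y)) \<in> L2 (K x)"
  using AE_space AE_integrable_kernel[OF L2_integrable[OF g]]
  by eventually_elim (use L2_rho_measurable[OF g] in \<open>simp add: L2_def measurable_section\<close>)

text \<open>Although \<rho> may be infinite and g not \<rho>-integrable, each fibre measure is
  finite, so square-integrable sections are integrable.\<close>

lemma AE_integrable_kernel_L2: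
  fixes g :: "'a \<times> 'a \<Rightarrow> 'k::l2_scalar"
  assumes g: "g \<in> L2 \<rho>"
  shows "AE x in M. integrable (K x) (\<lambda>y. g (x, y))"
  using AE_space AE_L2_kernel[OF g]
proof eventually_elim
  case (elim x)
  interpret subprob_space "K x"
    by (rule subprob_space_kernel[OF kernel elim(1)])
  show ?case by (rule L2_imp_integrable[OF elim(2)])
qed

text \<open>The squared norm of the average is at most the average of the squared norm on almost
  every fibre, and the latter is integrable over the base.\<close>

lemma fibre_average_L2:
  fixes g :: "'a \<times> 'a \<Rightarrow> 'k::l2_scalar"
  assumes g: "g \<in> L2 \<rho>"
  shows "fibre_average g \<in> L2 M"
proof -
  note [measurable] = L2_rho_measurable[OF g]
  have m [measurable]: "fibre_average g \<in> borel_measurable M"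
    unfolding fibre_average_def by measurable
  have "integrable M (\<lambda>x. (norm (fibre_average g x))\<^sup>2)"
  proof (rule Bochner_Integration.integrable_bound)
    show "integrable M (\<lambda>x. \<integral>y. (norm (g (x, y)))\<^sup>2 \<partial>K x)"
      by (rule integrable_integral_kernel[OF L2_integrable[OF g]])
    show "AE x in M. norm ((norm (fibre_average g x))\<^sup>2) \<le> norm (\<integral>y. (norm (g (x, y)))\<^sup>2 \<partial>K x)"
      using AE_space AE_L2_kernel[OF g]
    proof eventually_elim
      case (elim x)
      interpret subprob_space "K x"
        by (rule subprob_space_kernel[OF kernel elim(1)])
      show ?case
        using norm_integral_power2_le[OF elim(2)] by (simp add: fibre_average_def)
    qed
  qed measurable
  with m show ?thesis by (simp add: L2_def)
qed

text \<open>A \<rho>-null set meets almost every fibre in a null set. Stated through the integral of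
  \<open>norm (g - h)\<close>, this follows from the disintegration formula for nonnegative
  functions.\<close>

lemma fibre_average_cong_AE:
  fixes g h :: "'a \<times> 'a \<Rightarrow> 'k::l2_scalar"
  assumes "g \<in> L2 \<rho>" "h \<in> L2 \<rho>" "AE z in \<rho>. g z = h z"
  shows "AE x in M. fibre_average g x = fibre_average h x"
proof -
  have [measurable]: "g \<in> borel_measurable (M \<Otimes>\<^sub>M M)" "h \<in> borel_measurable (M \<Otimes>\<^sub>M M)"
    using assms by (simp_all add: L2_rho_measurable)
  have "(\<integral>\<^sup>+x. (\<integral>\<^sup>+y. ennreal (norm (g (x, y) - h (x, y))) \<partial>K x) \<partial>M) =
      (\<integral>\<^sup>+z. ennreal (norm (g z - h z)) \<partial>\<rho>)"
    by (subst nn_integral_rho) simp_all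
  also have "\<dots> = (\<integral>\<^sup>+z. 0 \<partial>\<rho>)"
    using assms(3) by (intro nn_integral_cong_AE) auto
  finally have "AE x in M. (\<integral>\<^sup>+y. ennreal (norm (g (x, y) - h (x, y))) \<partial>K x) = 0"
    by (subst nn_integral_0_iff_AE[symmetric]) (auto intro!: measurable_nn_integral_kernel[of "\<lambda>z. ennreal (norm (g z - h z))"])
  with AE_space show ?thesis
  proof eventually_elim
    case (elim x)
    note [measurable] = measurable_section[OF L2_rho_measurable elim(1)]
    have "AE y in K x. g (x, y) = h (x, y)"
      using elim(2) assms(1,2) by (subst (asm) nn_integral_0_iff_AE) auto
    then show ?case
      unfolding fibre_average_def using assms(1,2) by (intro integral_cong_AE) auto
  qed
qed

lemma operator_fibre_average:
  "L2_operator \<rho> M (L2 \<rho>) (fibre_average :: ('a \<times> 'a \<Rightarrow> 'k::l2_scalar) \<Rightarrow> _)"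
  unfolding L2_operator_def
proof (intro conjI ballI allI impI)
  fix g h :: "'a \<times> 'a \<Rightarrow> 'k" assume "g \<in> L2 \<rho>" "h \<in> L2 \<rho>"
  from this[THEN AE_integrable_kernel_L2]
  show "AE x in M. fibre_average (\<lambda>z. g z + h z) x = fibre_average g x + fibre_average h x"
    by eventually_elim (simp add: fibre_average_def)
next
  fix a and g :: "'a \<times> 'a \<Rightarrow> 'k" assume "g \<in> L2 \<rho>"
  from this[THEN AE_integrable_kernel_L2]
  show "AE x in M. fibre_average (\<lambda>z. a * g z) x = a * fibre_average g x"
    by eventually_elim (simp add: fibre_average_def)
qed (simp_all add: L2_subspace_L2 fibre_average_L2 fibre_average_cong_AE)

lemma adjoint_fibre_average:
  "L2_adjoint M \<rho> (J_op :: ('a \<Rightarrow> 'k::l2_scalar) \<Rightarrow> _) fibre_average"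
  unfolding L2_adjoint_def
proof (intro conjI ballI operator_fibre_average)
  show "L2_operator M \<rho> (L2 M) (J_op :: ('a \<Rightarrow> 'k) \<Rightarrow> _)"
    using isometry_J_op[where 'k = 'k] by (simp add: L2_isometry_def)
  fix f :: "'a \<Rightarrow> 'k" and g :: "'a \<times> 'a \<Rightarrow> 'k" assume f: "f \<in> L2 M" and g: "g \<in> L2 \<rho>"
  note [measurable] = L2_rho_measurable[OF g] L2_borel_measurable[OF f]
  have int: "integrable \<rho> (\<lambda>z. J_op f z * l2_conj (g z))"
    by (intro integrable_mult_l2_conj J_op_L2 f g)
  have "l2_inner \<rho> (J_op f) g = (\<integral>x. (\<integral>y. J_op f (x, y) * l2_conj (g (x, y)) \<partial>K x) \<partial>M)"
    unfolding l2_inner_def by (rule integral_rho[OF int])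
  also have "\<dots> = (\<integral>x. f x * l2_conj (fibre_average g x) \<partial>M)"
  proof (rule integral_cong_AE)
    \<comment> \<open>\<open>J_op f\<close> is constant along the fibre over x and leaves the inner
      integral; conjugation is bounded linear and commutes with it.\<close>
    show "AE x in M. (\<integral>y. J_op f (x, y) * l2_conj (g (x, y)) \<partial>K x) =
        f x * l2_conj (fibre_average g x)"
      using AE_integrable_kernel_L2[OF g]
    proof eventually_elim
      case (elim x)
      from integral_bounded_linear[OF bounded_linear_l2_conj elim]
        integrable_bounded_linear[OF bounded_linear_l2_conj elim]
      show ?case by (simp add: J_op_def fibre_average_def)
    qed
  qed (use fibre_average_L2[OF g] integrable_integral_kernel[OF int] in
      \<open>auto simp: L2_def\<close>)
  finally show "l2_inner \<rho> (J_op f) g = l2_inner M f (fibre_average g)"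
    by (simp add: l2_inner_def)
qed

end

section \<open>Disintegrations with finite fibres\<close>

lemma ennreal_mult_inverse_self: "0 < c \<Longrightarrow> c < \<infinity> \<Longrightarrow> c * inverse c = (1 :: ennreal)"
  using ennreal_divide_self[of c] by (auto simp: divide_ennreal_def)

locale finite_disintegration =
  fixes M :: "'a measure" and \<rho> :: "('a \<times> 'a) measure" and R :: "'a \<Rightarrow> 'a measure"
  assumes sets_eq: "sets \<rho> = sets (M \<Otimes>\<^sub>M M)"
    and disint: "disintegration M \<rho> R"
    and mass: "AE x in M. 0 < fibre_mass M R x \<and> fibre_mass M R x < \<infinity>"
begin

section \<open>Normalising the fibres\<close>

lemma sets_fibre: "x \<in> space M \<Longrightarrow> sets (R x) = sets M"
  using disint by (simp add: disintegration_def measurable_family_def)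

lemma measurable_emeasure_fibre [measurable]:
  "A \<in> sets M \<Longrightarrow> (\<lambda>x. emeasure (R x) A) \<in> borel_measurable M"
  using disint by (simp add: disintegration_def measurable_family_def)

lemma measurable_fibre_mass [measurable]: "fibre_mass M R \<in> borel_measurable M"
  unfolding fibre_mass_def by measurable

lemma sets_nu [simp, measurable_cong]: "sets (nu_measure M R) = sets M"
  by (simp add: nu_measure_def)

lemma space_nu [simp]: "space (nu_measure M R) = space M"
  by (simp add: nu_measure_def)

text \<open>The density c is positive almost everywhere, so \<mu> and \<nu> have the same null
  sets.\<close>

lemma AE_nu:
  "(AE x in nu_measure M R. P x) \<longleftrightarrow> (AE x in M. P x)"
  unfolding nu_measure_def using mass
  by (subst AE_density) (auto elim: AE_mp)

lemma transition_measurable: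
  "transition_measure M R \<in> measurable (nu_measure M R) (subprob_algebra (nu_measure M R))"
proof (rule measurable_subprob_algebra)
  fix x assume x: "x \<in> space (nu_measure M R)"
  then show "sets (transition_measure M R x) = sets (nu_measure M R)"
    by (simp add: transition_measure_def sets_fibre)
  have space: "space (R x) = space M"
    using x sets_eq_imp_space_eq[OF sets_fibre] by simp
  have "emeasure (transition_measure M R x) (space (transition_measure M R x)) =
      inverse (fibre_mass M R x) * fibre_mass M R x"
    by (simp add: transition_measure_def space_scale_measure space) (simp add: fibre_mass_def)
  also have "\<dots> \<le> 1"
  proof (cases "0 < fibre_mass M R x \<and> fibre_mass M R x < \<infinity>")
    case True
    then show ?thesis
      using ennreal_mult_inverse_self by (simp add: mult.commute)
  next
    \<comment> \<open>At mass 0 the factor is \<open>inverse 0 = \<infinity>\<close>, but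
      \<infinity> times 0 is 0; at mass \<infinity> the factor is 0. The product vanishes in both
      cases.\<close>
    case False
    then show ?thesis
      by (cases "fibre_mass M R x = 0") (auto simp: zero_less_iff_neq_zero not_less top_unique)
  qed
  finally show "subprob_space (transition_measure M R x)"
    using x by (intro subprob_spaceI) (auto simp: transition_measure_def space_scale_measure space)
next
  fix A assume "A \<in> sets (nu_measure M R)"
  then have "A \<in> sets M" by simp
  then show "(\<lambda>x. emeasure (transition_measure M R x) A) \<in> borel_measurable (nu_measure M R)"
    unfolding transition_measure_def emeasure_scale_measure by measurable
qed

text \<open>Integrating over \<nu> brings in the factor c, which cancels the inverse of c in the
  kernel wherever c is positive and finite.\<close>

sublocale markov_disintegration "nu_measure M R" \<rho> "transition_measure M R"
proof
  have sets_prod: "sets (nu_measure M R \<Otimes>\<^sub>M nu_measure M R) = sets (M \<Otimes>\<^sub>M M)"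
    by (intro sets_pair_measure_cong) simp_all
  with sets_eq show "sets \<rho> = sets (nu_measure M R \<Otimes>\<^sub>M nu_measure M R)" by simp
  show "transition_measure M R \<in> measurable (nu_measure M R) (subprob_algebra (nu_measure M R))"
    by (rule transition_measurable)
  have inverse_mass: "AE x in M. fibre_mass M R x * inverse (fibre_mass M R x) = 1"
    using mass by eventually_elim (rule ennreal_mult_inverse_self; simp)
  then show "AE x in nu_measure M R. emeasure (transition_measure M R x) (space (nu_measure M R)) = 1"
    unfolding AE_nu by eventually_elim (simp add: transition_measure_def fibre_mass_def mult.commute)
  fix f :: "'a \<times> 'a \<Rightarrow> ennreal"
  assume "f \<in> borel_measurable (nu_measure M R \<Otimes>\<^sub>M nu_measure M R)"
  then have f [measurable]: "f \<in> borel_measurable (M \<Otimes>\<^sub>M M)"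
    by (simp add: measurable_cong_sets[OF sets_prod refl])
  have inner [measurable]:
    "(\<lambda>x. \<integral>\<^sup>+ y. f (x, y) \<partial>transition_measure M R x) \<in> borel_measurable M"
  proof -
    have "(\<lambda>x. \<integral>\<^sup>+ y. f (x, y) \<partial>transition_measure M R x) \<in> borel_measurable (nu_measure M R)"
      by (rule nn_integral_measurable_subprob_algebra2[OF _ transition_measurable]) measurable
    then show ?thesis
      by (simp add: measurable_cong_sets[of "nu_measure M R" M])
  qed
  have "(\<integral>\<^sup>+ x. (\<integral>\<^sup>+ y. f (x, y) \<partial>transition_measure M R x) \<partial>nu_measure M R) =
      (\<integral>\<^sup>+ x. fibre_mass M R x * (\<integral>\<^sup>+ y. f (x, y) \<partial>transition_measure M R x) \<partial>M)"
    unfolding nu_measure_def by (rule nn_integral_density) measurable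
  also have "\<dots> = (\<integral>\<^sup>+ x. (\<integral>\<^sup>+ y. f (x, y) \<partial>R x) \<partial>M)"
    using inverse_mass AE_space
  proof (intro nn_integral_cong_AE, eventually_elim)
    fix x assume x: "fibre_mass M R x * inverse (fibre_mass M R x) = 1" "x \<in> space M"
    have "(\<lambda>y. f (x, y)) \<in> borel_measurable (R x)"
      using measurable_compose[OF measurable_Pair1'[OF x(2)] f]
      by (simp add: measurable_cong_sets[OF sets_fibre[OF x(2)] refl])
    then show "fibre_mass M R x * (\<integral>\<^sup>+ y. f (x, y) \<partial>transition_measure M R x) =
        (\<integral>\<^sup>+ y. f (x, y) \<partial>R x)"
      using x(1) by (simp add: transition_measure_def nn_integral_scale_measure flip: mult.assoc)
  qed
  also have "\<dots> = (\<integral>\<^sup>+ z. f z \<partial>\<rho>)"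
    using disint by (simp add: disintegration_def)
  finally show "(\<integral>\<^sup>+ z. f z \<partial>\<rho>) =
      (\<integral>\<^sup>+ x. (\<integral>\<^sup>+ y. f (x, y) \<partial>transition_measure M R x) \<partial>nu_measure M R)" ..
qed

section \<open>J as a densely defined operator on the space over \<mu>\<close>

lemma operator_J_op_domain:
  "L2_operator M \<rho> (J_domain M \<rho>) (J_op :: ('a \<Rightarrow> 'k::l2_scalar) \<Rightarrow> _)"
proof -
  have add: "J_op (\<lambda>x. f x + g x) = (\<lambda>z. J_op f z + J_op g z)" for f g :: "'a \<Rightarrow> 'k"
    by (simp add: J_op_def fun_eq_iff)
  have mult: "J_op (\<lambda>x. a * f x) = (\<lambda>z. a * J_op f z)" for a and f :: "'a \<Rightarrow> 'k"
    by (simp add: J_op_def fun_eq_iff)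
  have zero: "J_op (\<lambda>x. 0) = (\<lambda>z. 0 :: 'k)"
    by (simp add: J_op_def fun_eq_iff)
  have cong: "AE z in \<rho>. J_op f z = J_op g z" if "AE x in M. f x = g x" for f g :: "'a \<Rightarrow> 'k"
    using AE_fst[of "\<lambda>x. f x = g x"] that by (simp add: AE_nu J_op_def case_prod_beta)
  \<comment> \<open>The domain must not depend on the representative: equality \<mu>-almost
    everywhere passes through \<nu> to \<rho>, where it preserves integrability of the
    square.\<close>
  have closed: "J_op g \<in> L2 \<rho>"
    if f: "J_op f \<in> L2 \<rho>" and g: "g \<in> L2 M" and eq: "AE x in M. f x = g x" for f g :: "'a \<Rightarrow> 'k"
  proof -
    have "g \<in> borel_measurable M" using g by (rule L2_borel_measurable)
    then have m: "J_op g \<in> borel_measurable \<rho>"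
      unfolding J_op_def measurable_cong_sets[OF sets_eq refl] by measurable
    have "integrable \<rho> (\<lambda>z. (norm (J_op f z))\<^sup>2) = integrable \<rho> (\<lambda>z. (norm (J_op g z))\<^sup>2)"
      using cong[OF eq] m L2_borel_measurable[OF f]
      by (intro integrable_cong_AE) auto
    with m f show ?thesis by (simp add: L2_def)
  qed
  show ?thesis
    unfolding L2_operator_def L2_subspace_def J_domain_def
    using L2_subspace_L2[of M, where 'b = 'k] L2_subspace_L2[of \<rho>, where 'b = 'k]
    unfolding L2_subspace_def
    by (auto simp: add mult zero cong L2_add L2_mult_left intro: closed)
qed

lemma densely_defined_J_op: "L2_densely_defined M (J_domain M \<rho> :: ('a \<Rightarrow> 'k::l2_scalar) set)"
  unfolding L2_densely_defined_def
proof (intro ballI allI impI)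
  fix f :: "'a \<Rightarrow> 'k" and e :: real assume f: "f \<in> L2 M" and "0 < e"
  note [measurable] = L2_borel_measurable[OF f]
  define g where "g n x = (if fibre_mass M R x \<le> of_nat n then f x else 0)" for n x
  have g_meas [measurable]: "g n \<in> borel_measurable M" for n
    unfolding g_def by measurable
  have g_L2: "g n \<in> L2 M" for n
    by (rule L2_bound[OF g_meas L2_integrable[OF f]]) (simp add: g_def)
  have "g n \<in> J_domain M \<rho>" for n
  proof -
    \<comment> \<open>By \<open>J_op_L2\<close> it suffices that \<open>g n\<close> is
      square-integrable for \<nu>. Where \<open>g n\<close> is nonzero the density is at most n, so
      its squared norm over \<nu> is at most n times that of f over \<mu>.\<close>
    have "(\<integral>\<^sup>+x. ennreal ((norm (g n x))\<^sup>2) \<partial>nu_measure M R) =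
        (\<integral>\<^sup>+x. fibre_mass M R x * ennreal ((norm (g n x))\<^sup>2) \<partial>M)"
      unfolding nu_measure_def by (rule nn_integral_density) measurable
    also have "\<dots> \<le> (\<integral>\<^sup>+x. of_nat n * ennreal ((norm (f x))\<^sup>2) \<partial>M)"
      by (intro nn_integral_mono) (auto simp: g_def intro: mult_right_mono)
    also have "\<dots> = of_nat n * (\<integral>\<^sup>+x. ennreal ((norm (f x))\<^sup>2) \<partial>M)"
      by (rule nn_integral_cmult) measurable
    also have "\<dots> < \<infinity>"
      using L2_integrable[OF f] by (auto simp: integrable_iff_bounded ennreal_mult_less_top ennreal_of_nat_eq_real_of_nat)
    finally have "g n \<in> L2 (nu_measure M R)"
      by (simp add: L2_def integrable_iff_bounded)
    with g_L2 show ?thesis by (simp add: J_domain_def J_op_L2)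
  qed
  moreover have "(\<lambda>n. l2_norm M (\<lambda>x. f x - g n x)) \<longlonglongrightarrow> sqrt (\<integral>x. 0 \<partial>M)"
    unfolding l2_norm_def
  proof (intro tendsto_real_sqrt
      integral_dominated_convergence[where w = "\<lambda>x. (norm (f x))\<^sup>2"])
    show "AE x in M. (\<lambda>n. (norm (f x - g n x))\<^sup>2) \<longlonglongrightarrow> 0"
      using mass
    proof eventually_elim
      case (elim x)
      \<comment> \<open>Finiteness of c at x makes the truncation leave \<open>f x\<close> untouched
        from level m on, so the error is eventually exactly 0.\<close>
      then obtain m where m: "fibre_mass M R x < of_nat m"
        using ennreal_Ex_less_of_nat by auto
      have "g n x = f x" if "m \<le> n" for n
        using less_imp_le[OF m] order_trans[OF _ of_nat_mono[OF that, where 'a = ennreal]]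
        by (auto simp: g_def)
      then have "\<forall>\<^sub>F n in sequentially. (norm (f x - g n x))\<^sup>2 = 0"
        by (auto simp: eventually_sequentially intro!: exI[of _ m])
      then show ?case by (rule tendsto_eventually)
    qed
  qed (use L2_integrable[OF f] in \<open>auto simp: g_def\<close>)
  then have "\<forall>\<^sub>F n in sequentially. l2_norm M (\<lambda>x. f x - g n x) < e"
    using \<open>0 < e\<close> by (intro order_tendstoD(2)) simp_all
  then obtain n where "l2_norm M (\<lambda>x. f x - g n x) < e"
    by (auto simp: eventually_sequentially)
  ultimately show "\<exists>g\<in>J_domain M \<rho>. l2_norm M (\<lambda>x. f x - g x) < e"
    by blast
qed

end

section \<open>An unbounded example\<close>

lemma standard_borel_lborel: "standard_borel (lborel :: real measure)"
proof -
  obtain \<B> :: "real set set" where B: "countable \<B>" "topological_basis \<B>"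
    using ex_countable_basis by blast
  then have "second_countable (euclidean :: real topology)"
    unfolding second_countable_def
  proof (intro exI[of _ \<B>] conjI ballI allI impI)
    fix S :: "real set" and x assume "openin euclidean S \<and> x \<in> S"
    then show "\<exists>V\<in>\<B>. x \<in> V \<and> V \<subseteq> S"
      using topological_basisE[OF B(2), of S x] by auto
  qed (use B topological_basis_open in auto)
  then show ?thesis
    unfolding standard_borel_def
    by (intro exI[of _ euclidean]) (simp add: completely_metrizable_space_euclidean borel_def)
qed

text \<open>Cut A by a grid of intervals of length d, where d is below the measure of A. Countably
  many null pieces cannot make up A, so some piece has positive measure, and its measure is at most
  d.\<close>

lemma nonatomic_lborel: "nonatomic (lborel :: real measure)"
  unfolding nonatomic_def
proof (intro ballI impI)
  fix A :: "real set" assume A: "A \<in> sets lborel" and pos: "0 < emeasure lborel A"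
  \<comment> \<open>A length strictly below the measure of A is automatically finite, so sets A of
    infinite measure are covered as well.\<close>
  obtain d :: real where d: "0 < d" "ennreal d < emeasure lborel A"
  proof -
    obtain c where "0 < c" "c < emeasure lborel A"
      using dense[OF pos] by blast
    then show ?thesis
      using that by (cases c) auto
  qed
  define I where "I k = {real_of_int k * d..<(real_of_int k + 1) * d}" for k
  have [measurable]: "A \<in> sets borel" "I k \<in> sets borel" for k
    using A by (simp_all add: I_def)
  have "\<exists>k. x \<in> I k" for x
    using d(1) floor_divide_lower[OF d(1), of x] floor_divide_upper[OF d(1), of x]
    by (auto simp: I_def)
  then have cover: "(\<Union>k. A \<inter> I k) = A"
    by blast
  have "\<exists>k. emeasure lborel (A \<inter> I k) \<noteq> 0"
  proof (rule ccontr)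
    assume "\<not> (\<exists>k. emeasure lborel (A \<inter> I k) \<noteq> 0)"
    then have "(\<Union>k. A \<inter> I k) \<in> null_sets lborel"
      by (intro null_sets_UN) (auto simp: null_sets_def)
    then show False
      using pos cover by auto
  qed
  then obtain k where k: "emeasure lborel (A \<inter> I k) \<noteq> 0" ..
  have "emeasure lborel (A \<inter> I k) \<le> emeasure lborel (I k)"
    by (intro emeasure_mono) auto
  also have "\<dots> = ennreal d"
    using d(1) by (simp add: I_def algebra_simps)
  finally show "\<exists>B\<in>sets lborel. B \<subseteq> A \<and> 0 < emeasure lborel B \<and>
      emeasure lborel B < emeasure lborel A"
    using k d(2) by (intro bexI[of _ "A \<inter> I k"]) (auto simp: zero_less_iff_neq_zero)
qed

text \<open>The mass \<open>1 + \<bar>x\<bar>\<close> is carried by the point \<open>(x, x)\<close>: on the diagonal symmetry is automatic,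
  so that \<open>c\<close> may be any unbounded locally integrable function.\<close>

definition example_mass :: "real \<Rightarrow> ennreal" where
  "example_mass x = ennreal (1 + \<bar>x\<bar>)"

definition example_fibre :: "real \<Rightarrow> real measure" where
  "example_fibre x = scale_measure (example_mass x) (return lborel x)"

definition example_measure :: "(real \<times> real) measure" where
  "example_measure = distr (density lborel example_mass) (lborel \<Otimes>\<^sub>M lborel) (\<lambda>x. (x, x))"

lemma measurable_example_mass [measurable]: "example_mass \<in> borel_measurable borel"
  unfolding example_mass_def by measurable

lemma fibre_mass_example: "fibre_mass lborel example_fibre x = example_mass x"
  by (simp add: fibre_mass_def example_fibre_def)

lemma emeasure_example_Times:
  assumes [measurable]: "A \<in> sets borel" "B \<in> sets borel"
  shows "emeasure example_measure (A \<times> B) = emeasure (density lborel example_mass) (A \<inter> B)"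
proof -
  have "emeasure example_measure (A \<times> B) =
      emeasure (density lborel example_mass) ((\<lambda>x. (x, x)) -` (A \<times> B) \<inter> space (density lborel example_mass))"
    unfolding example_measure_def by (rule emeasure_distr) measurable
  also have "(\<lambda>x. (x, x)) -` (A \<times> B) \<inter> space (density lborel example_mass) = A \<inter> B"
    by auto
  finally show ?thesis .
qed

text \<open>On \<open>{a..b}\<close> with \<open>0 \<le> a\<close> the weight lies between
  \<open>1 + a\<close> and \<open>1 + b\<close>. The lower bound makes the operator norm grow;
  finiteness keeps the test functions in the domain.\<close>

lemma emeasure_density_example_Icc:
  assumes "0 \<le> a" "a \<le> b"
  shows "ennreal ((1 + a) * (b - a)) \<le> emeasure (density lborel example_mass) {a..b}"
    and "emeasure (density lborel example_mass) {a..b} < \<infinity>"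
proof -
  have eq: "emeasure (density lborel example_mass) {a..b} =
      (\<integral>\<^sup>+x. example_mass x * indicator {a..b} x \<partial>lborel)"
    by (rule emeasure_density) auto
  have "ennreal ((1 + a) * (b - a)) = (\<integral>\<^sup>+x. ennreal (1 + a) * indicator {a..b} x \<partial>lborel)"
    using assms by (simp add: nn_integral_cmult_indicator ennreal_mult)
  also have "\<dots> \<le> (\<integral>\<^sup>+x. example_mass x * indicator {a..b} x \<partial>lborel)"
    using assms by (intro nn_integral_mono) (auto simp: example_mass_def split: split_indicator intro!: ennreal_leI)
  finally show "ennreal ((1 + a) * (b - a)) \<le> emeasure (density lborel example_mass) {a..b}"
    unfolding eq .
  have "(\<integral>\<^sup>+x. example_mass x * indicator {a..b} x \<partial>lborel)
      \<le> (\<integral>\<^sup>+x. ennreal (1 + b) * indicator {a..b} x \<partial>lborel)"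
    using assms by (intro nn_integral_mono) (auto simp: example_mass_def split: split_indicator intro!: ennreal_leI)
  also have "\<dots> = ennreal (1 + b) * ennreal (b - a)"
    using assms by (simp add: nn_integral_cmult_indicator)
  also have "\<dots> < \<infinity>"
    by (simp add: ennreal_mult_less_top)
  finally show "emeasure (density lborel example_mass) {a..b} < \<infinity>"
    unfolding eq .
qed

lemma sigma_finite_example: "sigma_finite_measure example_measure"
proof
  \<comment> \<open>These squares exhaust the plane, and each meets the diagonal in a bounded
    segment on which the weight is at most \<open>1 + n\<close>.\<close>
  let ?A = "\<lambda>n::nat. {- real n..real n} \<times> {- real n..real n}"
  have space: "space example_measure = UNIV"
    by (simp add: example_measure_def space_pair_measure)
  have fin: "emeasure example_measure (?A n) \<noteq> \<infinity>" for n
  proof -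
    have "emeasure example_measure (?A n) =
        (\<integral>\<^sup>+x. example_mass x * indicator {- real n..real n} x \<partial>lborel)"
      by (subst emeasure_example_Times) (simp_all add: emeasure_density)
    also have "\<dots> \<le> (\<integral>\<^sup>+x. ennreal (1 + real n) * indicator {- real n..real n} x \<partial>lborel)"
      by (intro nn_integral_mono) (auto simp: example_mass_def split: split_indicator intro!: ennreal_leI)
    also have "\<dots> < \<infinity>"
      by (simp add: nn_integral_cmult_indicator ennreal_mult_less_top)
    finally show ?thesis by simp
  qed
  have cover: "\<Union> (range ?A) = UNIV"
  proof (intro set_eqI iffI UNIV_I)
    fix z :: "real \<times> real"
    obtain n :: nat where "max \<bar>fst z\<bar> \<bar>snd z\<bar> \<le> real n"
      using real_arch_simple by blast
    then show "z \<in> \<Union> (range ?A)"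
      by (cases z) (auto intro!: exI[of _ n])
  qed
  show "\<exists>A. countable A \<and> A \<subseteq> sets example_measure \<and> \<Union> A = space example_measure \<and>
      (\<forall>a\<in>A. emeasure example_measure a \<noteq> \<infinity>)"
    using fin cover by (intro exI[of _ "range ?A"]) (auto simp: space_pair_measure example_measure_def)
qed

lemma symmetric_example: "symmetric_measure lborel example_measure"
  unfolding symmetric_measure_def
  by (auto simp: sigma_finite_example emeasure_example_Times Int_commute)
    (simp_all add: example_measure_def)

lemma disintegration_example: "disintegration lborel example_measure example_fibre"
  unfolding disintegration_def measurable_family_def
proof (intro conjI ballI allI impI)
  fix A :: "real set" assume "A \<in> sets lborel"
  then show "(\<lambda>x. emeasure (example_fibre x) A) \<in> borel_measurable lborel"
    by (simp add: example_fibre_def)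
next
  fix f :: "real \<times> real \<Rightarrow> ennreal" assume [measurable]: "f \<in> borel_measurable (lborel \<Otimes>\<^sub>M lborel)"
  have "(\<integral>\<^sup>+ z. f z \<partial>example_measure) = (\<integral>\<^sup>+ x. f (x, x) \<partial>density lborel example_mass)"
    unfolding example_measure_def by (rule nn_integral_distr) measurable
  also have "\<dots> = (\<integral>\<^sup>+ x. example_mass x * f (x, x) \<partial>lborel)"
    by (rule nn_integral_density) measurable
  also have "\<dots> = (\<integral>\<^sup>+ x. (\<integral>\<^sup>+ y. f (x, y) \<partial>example_fibre x) \<partial>lborel)"
  proof (rule nn_integral_cong)
    fix x :: real
    have [measurable]: "(\<lambda>y. f (x, y)) \<in> borel_measurable lborel" by measurable
    show "example_mass x * f (x, x) = (\<integral>\<^sup>+ y. f (x, y) \<partial>example_fibre x)"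
      unfolding example_fibre_def
      by (simp add: nn_integral_scale_measure nn_integral_return)
  qed
  finally show "(\<integral>\<^sup>+ z. f z \<partial>example_measure) =
      (\<integral>\<^sup>+ x. (\<integral>\<^sup>+ y. f (x, y) \<partial>example_fibre x) \<partial>lborel)" .
qed (simp add: example_fibre_def)

text \<open>The indicator of \<open>{n..n + 1}\<close> has norm 1 for Lebesgue measure, while its
  image under J has squared norm equal to the weight of that interval, at least
  \<open>1 + n\<close>. Choosing n above \<open>C^2\<close> refutes the bound C.\<close>

lemma unbounded_example:
  "\<not> L2_bounded lborel example_measure (J_domain lborel example_measure)
    (J_op :: (real \<Rightarrow> 'k::l2_scalar) \<Rightarrow> _)"
proof
  assume "L2_bounded lborel example_measure (J_domain lborel example_measure)
    (J_op :: (real \<Rightarrow> 'k) \<Rightarrow> _)"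
  then obtain C where C: "l2_norm example_measure (J_op f) \<le> C * l2_norm lborel f"
    if "f \<in> J_domain lborel example_measure" for f :: "real \<Rightarrow> 'k"
    unfolding L2_bounded_def by blast
  obtain n :: nat where n: "C\<^sup>2 < real n"
    using reals_Archimedean2 by blast
  let ?I = "{real n..real n + 1}"
  let ?f = "\<lambda>x. indicator ?I x :: 'k"
  have norm_f: "(norm (?f x))\<^sup>2 = indicator ?I x" for x
    by (simp split: split_indicator)
  have norm_Jf: "(norm (J_op ?f z))\<^sup>2 = indicator (?I \<times> UNIV) z" for z
    by (cases z) (simp add: J_op_def split: split_indicator)
  have mass: "ennreal (1 + real n) \<le> emeasure example_measure (?I \<times> UNIV)"
    "emeasure example_measure (?I \<times> UNIV) < \<infinity>"
    using emeasure_density_example_Icc[of "real n" "real n + 1"]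
    by (simp_all add: emeasure_example_Times)
  have sets: "?I \<times> UNIV \<in> sets example_measure"
    by (simp add: example_measure_def)
  have "J_op ?f \<in> borel_measurable example_measure"
    unfolding J_op_def example_measure_def by measurable
  with mass sets have "?f \<in> J_domain lborel example_measure"
    by (simp add: J_domain_def L2_def norm_f norm_Jf)
  then have "l2_norm example_measure (J_op ?f) \<le> C * l2_norm lborel ?f"
    by (rule C)
  then have "sqrt (measure example_measure (?I \<times> UNIV)) \<le> C"
    using sets by (simp add: l2_norm_def norm_f norm_Jf)
  then have "measure example_measure (?I \<times> UNIV) \<le> C\<^sup>2"
    by (rule sqrt_le_D)
  moreover have "1 + real n \<le> measure example_measure (?I \<times> UNIV)"
  proof -
    have "emeasure example_measure (?I \<times> UNIV) =
        ennreal (measure example_measure (?I \<times> UNIV))"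
      using mass(2) by (intro emeasure_eq_ennreal_measure) auto
    with mass(1) show ?thesis
      by (simp only: ennreal_le_iff measure_nonneg)
  qed
  ultimately show False
    using n by simp
qed

(* The conjuncts: (1); then (2): the integrals in the formula converge, the formula defines the
   adjoint, and every operator that is adjoint to J is a co-isometry and agrees with the formula;
   then (3): J on its domain is an operator, it is densely defined, and it can be unbounded. *)
theorem theorem3p10:
  fixes \<mu> :: "'a measure" and \<rho> :: "('a \<times> 'a) measure" and R :: "'a \<Rightarrow> 'a measure"
  assumes "standard_measure_space \<mu>"
    and "symmetric_measure \<mu> \<rho>"
    and "disintegration \<mu> \<rho> R"
    and "AE x in \<mu>. 0 < fibre_mass \<mu> R x \<and> fibre_mass \<mu> R x < \<infinity>"
  shows
    "L2_isometry (nu_measure \<mu> R) \<rho> (J_op :: ('a \<Rightarrow> 'k::l2_scalar) \<Rightarrow> _) \<and>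

     (\<forall>g \<in> (L2 \<rho> :: ('a \<times> 'a \<Rightarrow> 'k) set).
        AE x in nu_measure \<mu> R. integrable (transition_measure \<mu> R x) (\<lambda>y. g (x, y))) \<and>
     L2_adjoint (nu_measure \<mu> R) \<rho> (J_op :: ('a \<Rightarrow> 'k) \<Rightarrow> _)
       (\<lambda>g x. \<integral>y. g (x, y) \<partial>transition_measure \<mu> R x) \<and>
     (\<forall>S. L2_adjoint (nu_measure \<mu> R) \<rho> (J_op :: ('a \<Rightarrow> 'k) \<Rightarrow> _) S \<longrightarrow>
        L2_coisometry \<rho> (nu_measure \<mu> R) S \<and>
        (\<forall>g\<in>L2 \<rho>. AE x in nu_measure \<mu> R.
           S g x = (\<integral>y. g (x, y) \<partial>transition_measure \<mu> R x))) \<and>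

     L2_operator \<mu> \<rho> (J_domain \<mu> \<rho>) (J_op :: ('a \<Rightarrow> 'k) \<Rightarrow> _) \<and>
     L2_densely_defined \<mu> (J_domain \<mu> \<rho> :: ('a \<Rightarrow> 'k) set) \<and>
     (\<exists>(\<mu>' :: real measure) \<rho>' R'.
        standard_measure_space \<mu>' \<and> symmetric_measure \<mu>' \<rho>' \<and> disintegration \<mu>' \<rho>' R' \<and>
        (AE x in \<mu>'. 0 < fibre_mass \<mu>' R' x \<and> fibre_mass \<mu>' R' x < \<infinity>) \<and>
        \<not> L2_bounded \<mu>' \<rho>' (J_domain \<mu>' \<rho>') (J_op :: (real \<Rightarrow> 'k) \<Rightarrow> _))"
proof -
  interpret finite_disintegration \<mu> \<rho> R
    using assms by unfold_locales (simp_all add: symmetric_measure_def)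
  have avg: "(\<lambda>g x. \<integral>y. g (x, y) \<partial>transition_measure \<mu> R x) =
      (fibre_average :: ('a \<times> 'a \<Rightarrow> 'k) \<Rightarrow> _)"
    by (simp add: fibre_average_def fun_eq_iff)
  note iso = isometry_J_op[where 'k = 'k]
  note adj = adjoint_fibre_average[where 'k = 'k, folded avg]
  \<comment> \<open>J itself is an adjoint of S by symmetry, and it is isometric; the formula
    follows by comparing S with the fibre average.\<close>
  have uniq: "L2_coisometry \<rho> (nu_measure \<mu> R) S \<and>
      (\<forall>g\<in>L2 \<rho>. AE x in nu_measure \<mu> R.
         S g x = (\<integral>y. g (x, y) \<partial>transition_measure \<mu> R x))"
    if S: "L2_adjoint (nu_measure \<mu> R) \<rho> (J_op :: ('a \<Rightarrow> 'k) \<Rightarrow> _) S" for S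
    using L2_adjoint_sym[OF S] iso L2_adjoint_unique[OF S adj]
    by (auto simp: L2_coisometry_def)
  have ex: "standard_measure_space (lborel :: real measure)"
    by (simp add: standard_measure_space_def standard_borel_lborel nonatomic_lborel
        lborel.sigma_finite_measure_axioms)
  show ?thesis
  proof (intro conjI)
    show "\<exists>(\<mu>' :: real measure) \<rho>' R'.
        standard_measure_space \<mu>' \<and> symmetric_measure \<mu>' \<rho>' \<and> disintegration \<mu>' \<rho>' R' \<and>
        (AE x in \<mu>'. 0 < fibre_mass \<mu>' R' x \<and> fibre_mass \<mu>' R' x < \<infinity>) \<and>
        \<not> L2_bounded \<mu>' \<rho>' (J_domain \<mu>' \<rho>') (J_op :: (real \<Rightarrow> 'k) \<Rightarrow> _)"
      using ex symmetric_example disintegration_example unbounded_example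
      by (intro exI[of _ "lborel :: real measure"] exI[of _ example_measure]
            exI[of _ example_fibre] conjI AE_I2)
        (simp_all add: fibre_mass_example example_mass_def del: ennreal_plus)
  qed (rule iso adj operator_J_op_domain densely_defined_J_op |
      intro ballI allI impI AE_integrable_kernel_L2 uniq; assumption)+
qed

end
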